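(* Let $0<\gamma<1$, $\lambda>0$, $\kappa\in[0,1)$, and let $X\sim\mathrm{SDS}(\gamma,\lambda,\kappa)$. Then $$\mathrm{E}|X|^r<\infty\quad\text{for any }0<r<2\gamma,\qquad \mathrm{E}|X|^r=\infty\quad\text{for any }r\ge2\gamma.$$
   Context: For $\gamma\in(0,1]$, $\lambda>0$, $\kappa\in[0,1)$, $\mathrm{SDS}(\gamma,\lambda,\kappa)$ denotes the symmetric distribution on $\mathbb{Z}$ with characteristic function $$f(t)=\exp\left\{-\lambda\left(\frac{(1-\cos t)(1+\kappa)}{\kappa^2-2\kappa\cos t+1}\right)^{\gamma}\right\}.$$ *)

theory Defs
  imports "HOL-Probability.Probability"
begin

definition sds_char :: "real \<Rightarrow> real \<Rightarrow> real \<Rightarrow> real \<Rightarrow> real" where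
  "sds_char \<gamma> lam \<kappa> t =
     exp (- lam * ((1 - cos t) * (1 + \<kappa>) / (\<kappa>\<^sup>2 - 2 * \<kappa> * cos t + 1)) powr \<gamma>)"

text \<open>
  A distribution on the integers is represented as a Borel probability measure on the
  reals that is concentrated on \<open>\<int>\<close>. A distribution is determined by its characteristic
  function, so for given parameters at most one measure satisfies the predicate.
\<close>

definition is_SDS :: "real \<Rightarrow> real \<Rightarrow> real \<Rightarrow> real measure \<Rightarrow> bool" where
  "is_SDS \<gamma> lam \<kappa> \<mu> \<longleftrightarrow>
     real_distribution \<mu> \<and>
     (AE x in \<mu>. x \<in> \<int>) \<and>
     distr \<mu> borel uminus = \<mu> \<and>
     (\<forall>t. char \<mu> t = complex_of_real (sds_char \<gamma> lam \<kappa> t))"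

end

theory Submission
  imports Defs
begin

text \<open>
  The moments of order below \<open>2\<close> of a distribution can be read off from its characteristic
  function \<open>f\<close> at the dyadic points \<open>2\<^sup>-\<^sup>k\<close>. Put \<open>q = 2\<^sup>r\<close>. For \<open>0 < r < 2\<close> the series
  \<open>S(x) = (\<Sum>k. q\<^sup>k (1 - cos (x / 2\<^sup>k)))\<close> is comparable to \<open>\<bar>x\<bar>\<^sup>r\<close>, up to multiplicative and
  additive constants: the term with \<open>2\<^sup>k \<approx> \<bar>x\<bar>\<close> is already of size \<open>\<bar>x\<bar>\<^sup>r\<close>, and the terms decay
  geometrically on both sides of it, because \<open>1 - cos u \<le> 2\<close> and \<open>r > 0\<close> control the smaller \<open>k\<close>,
  while \<open>1 - cos u \<le> u\<^sup>2 / 2\<close> and \<open>r < 2\<close> control the larger \<open>k\<close>. This is a discrete form of the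
  identity \<open>\<bar>x\<bar>\<^sup>r = C \<integral> (1 - cos (t x)) t\<^sup>-\<^sup>1\<^sup>-\<^sup>r dt\<close> over the positive half-line, in which only
  geometric series have to be summed.

  Integrating \<open>S\<close> term by term shows that \<open>E \<bar>X\<bar>\<^sup>r\<close> is finite exactly when
  \<open>(\<Sum>k. q\<^sup>k (1 - Re f(2\<^sup>-\<^sup>k)))\<close> converges
  (\<open>abs_moment_finite_iff_summable_char\<close>). For the SDS distribution \<open>1 - f(t)\<close> lies between two
  positive multiples of \<open>\<bar>t\<bar>\<close> to the power \<open>2\<gamma>\<close> on \<open>[-1, 1]\<close>
  (\<open>one_minus_sds_char_le\<close>, \<open>one_minus_sds_char_ge\<close>), so the series behaves like the geometric
  series with ratio \<open>2\<close> to the power \<open>r - 2\<gamma>\<close>. It converges for \<open>r < 2\<gamma>\<close> and diverges for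
  \<open>r = 2\<gamma>\<close>, an order that the criterion covers because \<open>\<gamma> < 1\<close>. Up to an
  additive constant, moments of larger order dominate the one of order \<open>2\<gamma>\<close>, so they are
  infinite as well.
\<close>

section \<open>Quadratic bounds for the cosine\<close>

lemma one_minus_cos_le:
  fixes x :: real
  shows "1 - cos x \<le> x\<^sup>2 / 2"
proof -
  have "(sin (x/2))\<^sup>2 \<le> (x/2)\<^sup>2"
    using abs_sin_x_le_abs_x[of "x/2"] by (simp only: abs_le_square_iff)
  moreover have "1 - cos x = 2 * (sin (x/2))\<^sup>2"
    using cos_double_sin[of "x/2"] by simp
  ultimately show ?thesis by (simp add: power_divide)
qed

text \<open>
  The range \<open>\<bar>x\<bar> \<le> 2\<close> has to reach up to \<open>2\<close>, because dyadic rescaling brings an arbitrary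
  \<open>\<bar>x\<bar> \<ge> 1\<close> only into \<open>[1, 2)\<close>. With \<open>1 - cos x = 2 sin\<^sup>2 (x/2)\<close> the bound comes from the
  cubic Taylor estimate of the sine.
\<close>

lemma one_minus_cos_ge:
  fixes x :: real
  assumes "\<bar>x\<bar> \<le> 2"
  shows "x\<^sup>2 / 4 \<le> 1 - cos x"
proof -
  define y where "y = x/2"
  have y: "\<bar>y\<bar> \<le> 1" using assms by (simp add: y_def)
  have "\<bar>sin y - (\<Sum>m<3. sin_coeff m * y ^ m)\<bar> \<le> inverse (fact 3) * \<bar>y\<bar> ^ 3"
    by (rule Maclaurin_sin_bound)
  hence "\<bar>sin y - y\<bar> \<le> \<bar>y\<bar> ^ 3 / 6"
    by (simp add: eval_nat_numeral sin_coeff_def field_simps)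
  moreover have "\<bar>y\<bar> ^ 3 \<le> \<bar>y\<bar>"
    using power_decreasing[of 1 3 "\<bar>y\<bar>"] y by simp
  ultimately have "\<bar>sin y - y\<bar> \<le> \<bar>y\<bar> / 6" by simp
  hence "\<bar>5/6 * y\<bar> \<le> \<bar>sin y\<bar>" by linarith
  hence "(5/6 * y)\<^sup>2 \<le> (sin y)\<^sup>2" by (simp only: abs_le_square_iff)
  moreover have "1 - cos x = 2 * (sin y)\<^sup>2"
    using cos_double_sin[of "x/2"] by (simp add: y_def)
  moreover have "x\<^sup>2 / 4 \<le> 2 * (5/6 * y)\<^sup>2"
    by (simp add: y_def power2_eq_square)
  ultimately show ?thesis by linarith
qed

section \<open>A dyadic cosine series comparable to a power\<close>

lemma ex_dyadic_scale:
  fixes x :: real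
  assumes "1 \<le> x"
  obtains k :: nat where "2 ^ k \<le> x" "x < 2 ^ Suc k"
proof -
  obtain m :: nat where "x < 2 ^ m" using real_arch_pow[of 2 x] by auto
  define n where "n = (LEAST m::nat. x < 2 ^ m)"
  have n: "x < 2 ^ n" unfolding n_def by (rule LeastI) fact
  with assms obtain k where k: "n = Suc k" by (cases n) auto
  have "\<not> x < 2 ^ k" using not_less_Least[of k "\<lambda>m. x < 2 ^ m"] k by (simp add: n_def)
  with n k show ?thesis using that[of k] by simp
qed

lemma power_powr:
  fixes b r :: real
  assumes "0 < b"
  shows "(b ^ k) powr r = (b powr r) ^ k"
  using assms by (induction k) (simp_all add: powr_mult)

text \<open>
  The summand \<open>1\<close> accounts for \<open>\<bar>x\<bar> < 1\<close>. For \<open>\<bar>x\<bar> \<ge> 1\<close> the single term with \<open>2\<^sup>k \<le> \<bar>x\<bar> < 2\<^sup>k\<^sup>+\<^sup>1\<close> suffices. Its cosine factor is at least \<open>1/4\<close>,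
  and replacing \<open>\<bar>x\<bar>\<close> by \<open>2\<^sup>k\<^sup>+\<^sup>1\<close> costs a factor \<open>2\<^sup>r\<close>, whence the constant \<open>4 \<cdot> 2\<^sup>r\<close>.
\<close>

lemma powr_le_dyadic_cos_sum:
  fixes x r :: real
  assumes "0 < r"
  shows "ennreal (\<bar>x\<bar> powr r)
    \<le> 1 + ennreal (4 * 2 powr r) * (\<Sum>k. ennreal ((2 powr r) ^ k * (1 - cos (x / 2 ^ k))))"
    (is "_ \<le> 1 + _ * ?S")
proof (cases "\<bar>x\<bar> < 1")
  case True
  hence "ennreal (\<bar>x\<bar> powr r) \<le> 1"
    using powr_mono2[of r "\<bar>x\<bar>" 1] assms by simp
  thus ?thesis by (rule add_increasing2[rotated]) simp
next
  case False
  then obtain k :: nat where k: "2 ^ k \<le> \<bar>x\<bar>" "\<bar>x\<bar> < 2 ^ Suc k"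
    using ex_dyadic_scale[of "\<bar>x\<bar>"] by auto
  have term_le_suminf: "f k \<le> suminf f" for f :: "nat \<Rightarrow> ennreal"
    using sum_le_suminf[OF summableI, of "{k}" f] by simp
  have u: "1 \<le> \<bar>x / 2 ^ k\<bar>" "\<bar>x / 2 ^ k\<bar> \<le> 2"
    using k by (auto simp: field_simps)
  have "1 \<le> (x / 2 ^ k)\<^sup>2"
    using u(1) abs_le_square_iff[of 1 "x / 2 ^ k"] by simp
  hence "1 / 4 \<le> (x / 2 ^ k)\<^sup>2 / 4"
    by (intro divide_right_mono) auto
  also have "\<dots> \<le> 1 - cos (x / 2 ^ k)"
    by (rule one_minus_cos_ge) fact
  finally have "1 \<le> 4 * (1 - cos (x / 2 ^ k))" by simp
  hence c: "(2 powr r) ^ k \<le> (2 powr r) ^ k * (4 * (1 - cos (x / 2 ^ k)))"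
    by (simp add: mult_le_cancel_left1)
  have "\<bar>x\<bar> powr r \<le> (2 ^ Suc k) powr r"
    using k assms by (intro powr_mono2) auto
  also have "\<dots> = 2 powr r * (2 powr r) ^ k"
    by (simp add: powr_mult power_powr)
  also have "\<dots> \<le> 2 powr r * ((2 powr r) ^ k * (4 * (1 - cos (x / 2 ^ k))))"
    by (intro mult_left_mono c) simp
  finally have "\<bar>x\<bar> powr r \<le> (4 * 2 powr r) * ((2 powr r) ^ k * (1 - cos (x / 2 ^ k)))"
    by (simp only: mult_ac)
  hence "ennreal (\<bar>x\<bar> powr r)
      \<le> ennreal (4 * 2 powr r) * ennreal ((2 powr r) ^ k * (1 - cos (x / 2 ^ k)))"
    by (subst ennreal_mult[symmetric]) (auto intro: ennreal_leI)
  also have "\<dots> \<le> ennreal (4 * 2 powr r) * ?S"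
    by (rule mult_left_mono, rule term_le_suminf) simp
  finally have "ennreal (\<bar>x\<bar> powr r) \<le> ennreal (4 * 2 powr r) * ?S" .
  thus ?thesis by (rule add_increasing[rotated]) simp
qed

text \<open>
  This estimate is used only for bounded \<open>x\<close>, where all terms lie in the range in which the
  quadratic bound on \<open>1 - cos\<close> is efficient; they then form a geometric series of ratio
  \<open>2\<^sup>r / 4 < 1\<close>.
\<close>

lemma dyadic_cos_partial_sum_le_square:
  fixes x r :: real
  assumes "r < 2"
  shows "(\<Sum>k<K. (2 powr r) ^ k * (1 - cos (x / 2 ^ k))) \<le> x\<^sup>2 / 2 / (1 - 2 powr r / 4)"
proof -
  have q: "2 powr r < 4" using powr_less_mono[of r 2 2] assms by simp
  have "(\<Sum>k<K. (2 powr r) ^ k * (1 - cos (x / 2 ^ k)))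
      \<le> (\<Sum>k<K. (2 powr r) ^ k * ((x / 2 ^ k)\<^sup>2 / 2))"
    by (intro sum_mono mult_left_mono one_minus_cos_le) auto
  also have "\<dots> = x\<^sup>2 / 2 * (\<Sum>k<K. (2 powr r / 4) ^ k)"
    by (simp add: sum_distrib_left power_divide power2_eq_square power_mult_distrib[symmetric]
        mult_ac)
  also have "\<dots> \<le> x\<^sup>2 / 2 * (\<Sum>k. (2 powr r / 4) ^ k)"
    using q by (intro mult_left_mono sum_le_suminf summable_geometric) auto
  also have "\<dots> = x\<^sup>2 / 2 / (1 - 2 powr r / 4)"
    using q by (subst suminf_geometric) auto
  finally show ?thesis .
qed

text \<open>
  Splitting off the first term of the partial sum \<open>S\<^sub>K\<^sub>+\<^sub>1\<close> gives the renormalisation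
  \<open>S\<^sub>K\<^sub>+\<^sub>1(x) = (1 - cos x) + 2\<^sup>r S\<^sub>K(x / 2)\<close>, under which \<open>\<bar>x\<bar>\<^sup>r\<close> is invariant; induction on
  \<open>K\<close> therefore replaces a split of the sum at \<open>2\<^sup>k \<approx> \<bar>x\<bar>\<close>. The bound \<open>A \<bar>x\<bar>\<^sup>r\<close> alone would not
  be inductive because of the extra \<open>1 - cos x \<le> 2\<close>. Subtracting \<open>B\<close> makes room for it: \<open>B\<close> is
  the solution of \<open>2\<^sup>r B - 2 = B\<close>. The constant \<open>D\<close> bounds the sum when \<open>\<bar>x\<bar> \<le> 2\<close>.
\<close>

lemma dyadic_cos_partial_sum_le_powr:
  fixes x r :: real
  assumes r: "0 < r" "r < 2" and x: "1 \<le> \<bar>x\<bar>"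
  defines "B \<equiv> 2 / (2 powr r - 1)" and "D \<equiv> 2 / (1 - 2 powr r / 4)"
  shows "(\<Sum>k<K. (2 powr r) ^ k * (1 - cos (x / 2 ^ k))) \<le> (B + D) * \<bar>x\<bar> powr r - B"
  using x
proof (induction K arbitrary: x)
  have q1: "1 < 2 powr r" using r by simp
  have q4: "2 powr r < 4" using powr_less_mono[of r 2 2] r by simp
  have BD: "0 < B" "0 < D" using q1 q4 by (auto simp: B_def D_def)
  have fixpoint: "(2 powr r - 1) * B = 2"
    using q1 unfolding B_def
    by (subst times_divide_eq_right, subst nonzero_mult_div_cancel_left) auto
  have one_le: "1 \<le> \<bar>x\<bar> powr r" if "1 \<le> \<bar>x\<bar>" for x :: real
    using that r by (simp add: ge_one_powr_ge_zero)
  have base: "D \<le> (B + D) * \<bar>x\<bar> powr r - B" if "1 \<le> \<bar>x\<bar>" for x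
    using mult_left_mono[OF one_le[OF that], of "B + D"] BD by (simp add: algebra_simps)
  {
    case 0
    show ?case using base[OF 0] BD by simp
  next
    case (Suc K)
    show ?case
    proof (cases "\<bar>x\<bar> \<le> 2")
      case True
      hence "x\<^sup>2 \<le> 4" using abs_le_square_iff[of x 2] by simp
      hence "x\<^sup>2 / 2 / (1 - 2 powr r / 4) \<le> D"
        unfolding D_def using q4 by (intro divide_right_mono) auto
      with dyadic_cos_partial_sum_le_square[OF r(2), of x "Suc K"] base[OF Suc.prems]
      show ?thesis by linarith
    next
      case False
      let ?S = "\<Sum>k<K. (2 powr r) ^ k * (1 - cos (x / 2 / 2 ^ k))"
      have IH: "?S \<le> (B + D) * \<bar>x / 2\<bar> powr r - B"
        using False by (intro Suc.IH) simp
      have scale: "2 powr r * \<bar>x / 2\<bar> powr r = \<bar>x\<bar> powr r"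
        by (simp add: powr_mult[symmetric])
      have "(\<Sum>k<Suc K. (2 powr r) ^ k * (1 - cos (x / 2 ^ k))) = (1 - cos x) + 2 powr r * ?S"
        by (subst sum.lessThan_Suc_shift) (simp add: sum_distrib_left mult_ac)
      also have "\<dots> \<le> 2 + 2 powr r * ((B + D) * \<bar>x / 2\<bar> powr r - B)"
        using cos_ge_minus_one[of x] by (intro add_mono mult_left_mono IH) (linarith, simp)
      also have "\<dots> = 2 + (B + D) * (2 powr r * \<bar>x / 2\<bar> powr r) - 2 powr r * B"
        by (simp add: algebra_simps)
      also have "\<dots> = (B + D) * \<bar>x\<bar> powr r - (2 powr r * B - 2)"
        unfolding scale by linarith
      also have "2 powr r * B - 2 = B"
        using fixpoint by (simp add: algebra_simps)
      finally show ?thesis .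
    qed
  }
qed

lemma dyadic_cos_sum_le_powr:
  fixes r :: real
  assumes r: "0 < r" "r < 2"
  obtains A D :: real where "0 \<le> A" "0 \<le> D"
    "\<And>x. (\<Sum>k. ennreal ((2 powr r) ^ k * (1 - cos (x / 2 ^ k)))) \<le> ennreal (A * \<bar>x\<bar> powr r + D)"
proof -
  define B D where "B = 2 / (2 powr r - 1)" and "D = 2 / (1 - 2 powr r / 4)"
  have q1: "1 < 2 powr r" using r by simp
  have q4: "2 powr r < 4" using powr_less_mono[of r 2 2] r by simp
  have BD: "0 < B" "0 < D" using q1 q4 by (auto simp: B_def D_def)
  have partial: "(\<Sum>k<K. (2 powr r) ^ k * (1 - cos (x / 2 ^ k))) \<le> (B + D) * \<bar>x\<bar> powr r + D"
    for x K
  proof (cases "1 \<le> \<bar>x\<bar>")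
    case True
    show ?thesis
      using dyadic_cos_partial_sum_le_powr[OF r True, of K] BD unfolding B_def D_def by linarith
  next
    case False
    hence "x\<^sup>2 \<le> 1" using abs_le_square_iff[of x 1] by simp
    hence "x\<^sup>2 / 2 / (1 - 2 powr r / 4) \<le> D"
      unfolding D_def using q4 by (intro divide_right_mono) auto
    moreover have "0 \<le> (B + D) * \<bar>x\<bar> powr r" using BD by simp
    ultimately show ?thesis
      using dyadic_cos_partial_sum_le_square[OF r(2), of x K] by linarith
  qed
  show thesis
  proof
    show "0 \<le> B + D" "0 \<le> D" using BD by auto
    show "(\<Sum>k. ennreal ((2 powr r) ^ k * (1 - cos (x / 2 ^ k))))
        \<le> ennreal ((B + D) * \<bar>x\<bar> powr r + D)" for x
      by (rule suminf_le_const) (auto simp: partial ennreal_leI sum_ennreal)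
  qed
qed

section \<open>Absolute moments and the characteristic function\<close>

lemma (in real_distribution) nn_integral_one_minus_cos:
  "(\<integral>\<^sup>+ x. ennreal (1 - cos (t * x)) \<partial>M) = ennreal (1 - Re (char M t))"
proof -
  have int: "integrable M (\<lambda>x. iexp (t * x))"
    by (rule integrable_iexp) auto
  have "Re (char M t) = (\<integral>x. Re (iexp (t * x)) \<partial>M)"
    unfolding char_def using int by simp
  also have "\<dots> = (\<integral>x. cos (t * x) \<partial>M)"
    by (simp add: Re_exp)
  finally have Re: "Re (char M t) = (\<integral>x. cos (t * x) \<partial>M)" .
  have intc: "integrable M (\<lambda>x. cos (t * x))"
    by (rule integrable_const_bound[of _ 1]) auto
  have "(\<integral>\<^sup>+ x. ennreal (1 - cos (t * x)) \<partial>M) = ennreal (\<integral>x. 1 - cos (t * x) \<partial>M)"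
    using intc by (intro nn_integral_eq_integral) auto
  also have "(\<integral>x. 1 - cos (t * x) \<partial>M) = 1 - Re (char M t)"
    using intc prob_space by (simp add: Re)
  finally show ?thesis .
qed

text \<open>
  All terms of the dyadic series are nonnegative, so integration may be exchanged with summation
  whether or not the moment is finite; the two pointwise comparisons above then give the two
  implications.
\<close>

theorem (in real_distribution) abs_moment_finite_iff_summable_char:
  assumes r: "0 < r" "r < 2"
  shows "(\<integral>\<^sup>+ x. ennreal (\<bar>x\<bar> powr r) \<partial>M) < \<infinity> \<longleftrightarrow>
    summable (\<lambda>k. (2 powr r) ^ k * (1 - Re (char M (1 / 2 ^ k))))"
proof -
  let ?c = "\<lambda>k. (2 powr r) ^ k * (1 - Re (char M (1 / 2 ^ k)))"
  let ?S = "\<lambda>x. \<Sum>k. ennreal ((2 powr r) ^ k * (1 - cos (x / 2 ^ k)))"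
  have c: "0 \<le> ?c k" for k
    using cmod_char_le_1[of "1 / 2 ^ k"] complex_Re_le_cmod[of "char M (1 / 2 ^ k)"]
    by (intro mult_nonneg_nonneg) auto
  have "(\<integral>\<^sup>+ x. ?S x \<partial>M) = (\<Sum>k. \<integral>\<^sup>+ x. ennreal ((2 powr r) ^ k * (1 - cos (x / 2 ^ k))) \<partial>M)"
    by (rule nn_integral_suminf) measurable
  also have "\<dots> = (\<Sum>k. ennreal (?c k))"
  proof (rule suminf_cong)
    fix k
    have "(\<integral>\<^sup>+ x. ennreal ((2 powr r) ^ k * (1 - cos (x / 2 ^ k))) \<partial>M)
        = (\<integral>\<^sup>+ x. ennreal ((2 powr r) ^ k) * ennreal (1 - cos (1 / 2 ^ k * x)) \<partial>M)"
      by (simp add: ennreal_mult)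
    also have "\<dots> = ennreal ((2 powr r) ^ k) * ennreal (1 - Re (char M (1 / 2 ^ k)))"
      by (subst nn_integral_cmult) (simp_all only: nn_integral_one_minus_cos, measurable)
    also have "\<dots> = ennreal (?c k)"
      by (simp add: ennreal_mult')
    finally show "(\<integral>\<^sup>+ x. ennreal ((2 powr r) ^ k * (1 - cos (x / 2 ^ k))) \<partial>M) = ennreal (?c k)" .
  qed
  finally have S: "(\<integral>\<^sup>+ x. ?S x \<partial>M) = (\<Sum>k. ennreal (?c k))" .
  have affine: "(\<integral>\<^sup>+ x. a + b * h x \<partial>M) = a + b * (\<integral>\<^sup>+ x. h x \<partial>M)"
    if "h \<in> borel_measurable M" for h :: "real \<Rightarrow> ennreal" and a b
    using that by (simp add: nn_integral_add nn_integral_cmult emeasure_space_1 del: space_eq_univ)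
  show ?thesis
  proof
    assume fin: "(\<integral>\<^sup>+ x. ennreal (\<bar>x\<bar> powr r) \<partial>M) < \<infinity>"
    obtain A D where AD: "0 \<le> A" "0 \<le> D" "\<And>x. ?S x \<le> ennreal (A * \<bar>x\<bar> powr r + D)"
      by (rule dyadic_cos_sum_le_powr[OF r]) blast
    have "(\<integral>\<^sup>+ x. ?S x \<partial>M) \<le> (\<integral>\<^sup>+ x. ennreal (A * \<bar>x\<bar> powr r + D) \<partial>M)"
      by (intro nn_integral_mono AD)
    also have "\<dots> = (\<integral>\<^sup>+ x. ennreal D + ennreal A * ennreal (\<bar>x\<bar> powr r) \<partial>M)"
      using AD by (simp add: ennreal_mult add.commute)
    also have "\<dots> = ennreal D + ennreal A * (\<integral>\<^sup>+ x. ennreal (\<bar>x\<bar> powr r) \<partial>M)"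
      by (rule affine) measurable
    also have "\<dots> < \<infinity>"
      using fin by (simp add: ennreal_mult_less_top)
    finally have "(\<Sum>k. ennreal (?c k)) \<noteq> top"
      unfolding S by (simp only: infinity_ennreal_def less_top)
    thus "summable ?c" by (rule summable_suminf_not_top[OF c])
  next
    assume "summable ?c"
    hence "(\<Sum>k. ennreal (?c k)) \<noteq> top" by (rule ennreal_suminf_neq_top[OF _ c])
    hence fin: "(\<Sum>k. ennreal (?c k)) < \<infinity>" by (simp only: infinity_ennreal_def less_top)
    have "(\<integral>\<^sup>+ x. ennreal (\<bar>x\<bar> powr r) \<partial>M) \<le> (\<integral>\<^sup>+ x. 1 + ennreal (4 * 2 powr r) * ?S x \<partial>M)"
      by (intro nn_integral_mono powr_le_dyadic_cos_sum r)
    also have "\<dots> = 1 + ennreal (4 * 2 powr r) * (\<integral>\<^sup>+ x. ?S x \<partial>M)"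
      by (rule affine) measurable
    also have "\<dots> < \<infinity>"
      using fin unfolding S by (simp add: ennreal_mult_less_top)
    finally show "(\<integral>\<^sup>+ x. ennreal (\<bar>x\<bar> powr r) \<partial>M) < \<infinity>" .
  qed
qed

section \<open>The SDS characteristic function near the origin\<close>

text \<open>
  The denominator is \<open>\<bar>1 - \<kappa> e\<^sup>i\<^sup>t\<bar>\<^sup>2\<close>, which \<open>\<kappa> < 1\<close> keeps away from zero.
\<close>

lemma sds_denominator_bounds:
  fixes \<kappa> t :: real
  assumes "0 \<le> \<kappa>" "\<kappa> < 1"
  shows "(1 - \<kappa>)\<^sup>2 \<le> \<kappa>\<^sup>2 - 2 * \<kappa> * cos t + 1" "\<kappa>\<^sup>2 - 2 * \<kappa> * cos t + 1 \<le> 4"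
proof -
  have "\<kappa> * cos t \<le> \<kappa> * 1" "\<kappa> * (-1) \<le> \<kappa> * cos t"
    using assms by (intro mult_left_mono; simp)+
  moreover have "\<kappa>\<^sup>2 \<le> 1" using assms by (simp add: power_le_one)
  ultimately show "(1 - \<kappa>)\<^sup>2 \<le> \<kappa>\<^sup>2 - 2 * \<kappa> * cos t + 1" "\<kappa>\<^sup>2 - 2 * \<kappa> * cos t + 1 \<le> 4"
    using assms by (auto simp: power2_eq_square algebra_simps)
qed

lemma one_minus_sds_char_le:
  assumes "0 < \<gamma>" "0 < lam" "0 \<le> \<kappa>" "\<kappa> < 1"
  shows "1 - sds_char \<gamma> lam \<kappa> t \<le> lam / ((1 - \<kappa>)\<^sup>2) powr \<gamma> * (t\<^sup>2) powr \<gamma>"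
proof -
  let ?d = "\<kappa>\<^sup>2 - 2 * \<kappa> * cos t + 1"
  let ?u = "(1 - cos t) * (1 + \<kappa>) / ?d"
  have pos: "0 < (1 - \<kappa>)\<^sup>2" using assms by simp
  have d: "(1 - \<kappa>)\<^sup>2 \<le> ?d" by (rule sds_denominator_bounds) fact+
  with pos have "0 < ?d" by linarith
  have "(1 - cos t) * (1 + \<kappa>) \<le> t\<^sup>2 / 2 * 2"
    using assms by (intro mult_mono one_minus_cos_le) auto
  hence "?u \<le> t\<^sup>2 / (1 - \<kappa>)\<^sup>2"
    using d pos by (intro frac_le) auto
  moreover have "0 \<le> ?u"
    using \<open>0 < ?d\<close> assms by (intro divide_nonneg_nonneg mult_nonneg_nonneg) auto
  ultimately have "?u powr \<gamma> \<le> (t\<^sup>2 / (1 - \<kappa>)\<^sup>2) powr \<gamma>"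
    using assms by (intro powr_mono2) auto
  also have "\<dots> = (t\<^sup>2) powr \<gamma> / ((1 - \<kappa>)\<^sup>2) powr \<gamma>"
    by (simp add: powr_divide)
  finally have "lam * ?u powr \<gamma> \<le> lam * ((t\<^sup>2) powr \<gamma> / ((1 - \<kappa>)\<^sup>2) powr \<gamma>)"
    using assms by (intro mult_left_mono) auto
  moreover have "1 - lam * ?u powr \<gamma> \<le> sds_char \<gamma> lam \<kappa> t"
    unfolding sds_char_def using exp_ge_add_one_self[of "- lam * ?u powr \<gamma>"] by simp
  ultimately show ?thesis by simp
qed

text \<open>
  The exponent of \<open>f(t)\<close> is at most \<open>- v s\<close> with \<open>s = \<bar>t\<bar>\<close> to the power \<open>2\<gamma>\<close>, since
  \<open>(1 - cos t) (1 + \<kappa>) \<ge> t\<^sup>2 / 4\<close> and the denominator is at most \<open>4\<close>. As \<open>s \<le> 1\<close>, convexity of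
  the exponential function places \<open>exp (- v s)\<close> below its chord on \<open>[0, 1]\<close>, which has slope
  \<open>- (1 - exp (- v))\<close>.
\<close>

lemma one_minus_sds_char_ge:
  assumes "0 < \<gamma>" "0 < lam" "0 \<le> \<kappa>" "\<kappa> < 1"
  obtains a where "0 < a" "\<And>t. \<bar>t\<bar> \<le> 1 \<Longrightarrow> a * (t\<^sup>2) powr \<gamma> \<le> 1 - sds_char \<gamma> lam \<kappa> t"
proof -
  have pos: "0 < (1 - \<kappa>)\<^sup>2" using assms by simp
  define v where "v = lam * (1/16) powr \<gamma>"
  have v: "0 < v" using assms by (simp add: v_def)
  show thesis
  proof
    show "0 < 1 - exp (- v)" using v by simp
    fix t :: real assume t: "\<bar>t\<bar> \<le> 1"
    let ?d = "\<kappa>\<^sup>2 - 2 * \<kappa> * cos t + 1"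
    let ?u = "(1 - cos t) * (1 + \<kappa>) / ?d"
    let ?s = "(t\<^sup>2) powr \<gamma>"
    have s: "0 \<le> ?s" "?s \<le> 1"
      using t abs_le_square_iff[of t 1] assms powr_mono2[of \<gamma> "t\<^sup>2" 1] by auto
    have d: "(1 - \<kappa>)\<^sup>2 \<le> ?d" "?d \<le> 4" by (rule sds_denominator_bounds; fact)+
    with pos have "0 < ?d" by linarith
    have "t\<^sup>2 / 4 * 1 \<le> (1 - cos t) * (1 + \<kappa>)"
      using assms t by (intro mult_mono one_minus_cos_ge) auto
    hence "t\<^sup>2 / 4 / 4 \<le> ?u"
      using d \<open>0 < ?d\<close> assms by (intro frac_le) auto
    hence "(1/16 * t\<^sup>2) powr \<gamma> \<le> ?u powr \<gamma>"
      using assms by (intro powr_mono2) auto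
    hence "lam * (1/16 * t\<^sup>2) powr \<gamma> \<le> lam * ?u powr \<gamma>"
      using assms by (intro mult_left_mono) auto
    moreover have "lam * (1/16 * t\<^sup>2) powr \<gamma> = v * ?s"
      by (simp add: v_def powr_mult powr_divide)
    ultimately have "sds_char \<gamma> lam \<kappa> t \<le> exp (- (v * ?s))"
      unfolding sds_char_def by simp
    also have "exp (- (v * ?s)) = exp ((1 - ?s) * 0 + ?s * (- v))" by (simp add: mult.commute)
    also have "\<dots> \<le> (1 - ?s) * exp 0 + ?s * exp (- v)"
      using convex_onD[OF exp_convex, of ?s 0 "- v"] s by simp
    finally show "(1 - exp (- v)) * ?s \<le> 1 - sds_char \<gamma> lam \<kappa> t"
      by (simp add: algebra_simps)
  qed
qed

section \<open>Moments of the SDS distribution\<close>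

theorem theorem5p8:
  fixes \<gamma> lam \<kappa> :: real and M :: "'a measure" and X :: "'a \<Rightarrow> real"
  assumes "0 < \<gamma>" and "\<gamma> < 1"
    and "0 < lam"
    and "0 \<le> \<kappa>" and "\<kappa> < 1"
    and "prob_space M"
    and "X \<in> borel_measurable M"
    and "is_SDS \<gamma> lam \<kappa> (distr M borel X)"
  shows "(\<forall>r. 0 < r \<and> r < 2 * \<gamma> \<longrightarrow> (\<integral>\<^sup>+ \<omega>. ennreal (\<bar>X \<omega>\<bar> powr r) \<partial>M) < \<infinity>) \<and>
         (\<forall>r. 2 * \<gamma> \<le> r \<longrightarrow> (\<integral>\<^sup>+ \<omega>. ennreal (\<bar>X \<omega>\<bar> powr r) \<partial>M) = \<infinity>)"
proof -
  note par = \<open>0 < \<gamma>\<close> \<open>0 < lam\<close> \<open>0 \<le> \<kappa>\<close> \<open>\<kappa> < 1\<close>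
  note [measurable] = \<open>X \<in> borel_measurable M\<close>
  interpret prob_space M by fact
  interpret D: real_distribution "distr M borel X"
    using \<open>is_SDS \<gamma> lam \<kappa> (distr M borel X)\<close> by (simp add: is_SDS_def)
  let ?c = "\<lambda>r k. (2 powr r) ^ k * (1 - sds_char \<gamma> lam \<kappa> (1 / 2 ^ k))"
  have moment_iff: "(\<integral>\<^sup>+ \<omega>. ennreal (\<bar>X \<omega>\<bar> powr r) \<partial>M) < \<infinity> \<longleftrightarrow> summable (?c r)"
    if "0 < r" "r < 2" for r
    using D.abs_moment_finite_iff_summable_char[OF that]
      \<open>is_SDS \<gamma> lam \<kappa> (distr M borel X)\<close>
    by (simp add: is_SDS_def nn_integral_distr)
  have scale: "((1 / 2 ^ k)\<^sup>2) powr \<gamma> = (2 powr (- (2 * \<gamma>))) ^ k" for k :: nat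
  proof -
    have "((1 / 2 ^ k)\<^sup>2) powr \<gamma> = ((1 / 4) powr \<gamma>) ^ k"
      by (simp add: power_powr[symmetric] power_divide power2_eq_square flip: power_mult_distrib)
    also have "(1 / 4 :: real) = 2 powr (- 2)" by (simp add: powr_minus)
    also have "(2 powr (- 2)) powr \<gamma> = 2 powr (- (2 * \<gamma>))" by (simp only: powr_powr) simp
    finally show ?thesis .
  qed
  have finite_moment: "(\<integral>\<^sup>+ \<omega>. ennreal (\<bar>X \<omega>\<bar> powr r) \<partial>M) < \<infinity>" if r: "0 < r" "r < 2 * \<gamma>" for r
  proof -
    define V where "V = lam / ((1 - \<kappa>)\<^sup>2) powr \<gamma>"
    have "summable (?c r)"
    proof (rule summable_comparison_test')
      have "2 powr (r - 2 * \<gamma>) < (1::real)"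
        using r by (simp add: powr_less_one)
      thus "summable (\<lambda>k. V * (2 powr (r - 2 * \<gamma>)) ^ k)"
        by (intro summable_mult summable_geometric) simp
      fix k :: nat
      have "0 \<le> 1 - sds_char \<gamma> lam \<kappa> (1 / 2 ^ k)"
        using par by (simp add: sds_char_def)
      hence "norm (?c r k) = ?c r k" by simp
      also have "\<dots> \<le> (2 powr r) ^ k * (V * (2 powr (- (2 * \<gamma>))) ^ k)"
        using one_minus_sds_char_le[OF par, of "1 / 2 ^ k"] unfolding scale V_def
        by (intro mult_left_mono) auto
      also have "\<dots> = V * (2 powr (r - 2 * \<gamma>)) ^ k"
        by (simp add: power_mult_distrib[symmetric] powr_add[symmetric])
      finally show "norm (?c r k) \<le> V * (2 powr (r - 2 * \<gamma>)) ^ k" .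
    qed
    with moment_iff[of r] r \<open>\<gamma> < 1\<close> show ?thesis by simp
  qed
  have critical: "\<not> summable (?c (2 * \<gamma>))"
  proof
    assume "summable (?c (2 * \<gamma>))"
    \<comment> \<open>At the critical order the terms do not even tend to zero: the two powers of \<open>2\<close> cancel.\<close>
    hence "?c (2 * \<gamma>) \<longlonglongrightarrow> 0" by (rule summable_LIMSEQ_zero)
    obtain a where a: "0 < a" "\<And>t. \<bar>t\<bar> \<le> 1 \<Longrightarrow> a * (t\<^sup>2) powr \<gamma> \<le> 1 - sds_char \<gamma> lam \<kappa> t"
      by (rule one_minus_sds_char_ge[OF par]) blast
    have "a \<le> ?c (2 * \<gamma>) k" for k
    proof -
      have "a * (2 powr (- (2 * \<gamma>))) ^ k \<le> 1 - sds_char \<gamma> lam \<kappa> (1 / 2 ^ k)"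
        using a(2)[of "1 / 2 ^ k"] unfolding scale by simp
      hence "(2 powr (2 * \<gamma>)) ^ k * (a * (2 powr (- (2 * \<gamma>))) ^ k) \<le> ?c (2 * \<gamma>) k"
        by (intro mult_left_mono) auto
      moreover have "(2 powr (2 * \<gamma>)) ^ k * (a * (2 powr (- (2 * \<gamma>))) ^ k) = a"
        by (simp add: power_mult_distrib[symmetric] powr_add[symmetric] mult.left_commute)
      ultimately show ?thesis by simp
    qed
    with \<open>?c (2 * \<gamma>) \<longlonglongrightarrow> 0\<close> have "a \<le> 0"
      by (intro LIMSEQ_le_const) auto
    with a(1) show False by simp
  qed
  have infinite_moment: "(\<integral>\<^sup>+ \<omega>. ennreal (\<bar>X \<omega>\<bar> powr r) \<partial>M) = \<infinity>" if r: "2 * \<gamma> \<le> r" for r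
  proof (rule ccontr)
    assume "(\<integral>\<^sup>+ \<omega>. ennreal (\<bar>X \<omega>\<bar> powr r) \<partial>M) \<noteq> \<infinity>"
    hence fin: "(\<integral>\<^sup>+ \<omega>. ennreal (\<bar>X \<omega>\<bar> powr r) \<partial>M) < \<infinity>" by (simp add: less_top)
    have le: "x powr (2 * \<gamma>) \<le> 1 + x powr r" if "0 \<le> x" for x :: real
    proof (cases "x \<le> 1")
      case True
      thus ?thesis using powr_mono2[of "2 * \<gamma>" x 1] that par(1)
        by (simp add: add_increasing2)
    next
      case False
      thus ?thesis using powr_mono[OF r, of x] by linarith
    qed
    have "(\<integral>\<^sup>+ \<omega>. ennreal (\<bar>X \<omega>\<bar> powr (2 * \<gamma>)) \<partial>M) \<le> (\<integral>\<^sup>+ \<omega>. 1 + ennreal (\<bar>X \<omega>\<bar> powr r) \<partial>M)"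
      by (intro nn_integral_mono) (simp add: le flip: ennreal_1 ennreal_plus)
    also have "\<dots> = 1 + (\<integral>\<^sup>+ \<omega>. ennreal (\<bar>X \<omega>\<bar> powr r) \<partial>M)"
      by (simp add: nn_integral_add emeasure_space_1)
    also have "\<dots> < \<infinity>" using fin by simp
    finally show False
      using moment_iff[of "2 * \<gamma>"] critical par(1) \<open>\<gamma> < 1\<close> by simp
  qed
  show ?thesis using finite_moment infinite_moment by blast
qed

end
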